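(* Let $f\in\mathbb{R}[x_1,\dots,x_n]$ be a polynomial and $S\subset\mathbb{R}^n$ a semi-algebraic set. Consider the polynomial optimization problem $f^\star=\inf_{x\in S}f(x)$, with $f^\star\in\mathbb{R}$. Assume that the image $f(S)$ is bounded. Let $Q=\overline{f(S)}$ and let $g(t)=t$. Then there exist $w\in\mathbb{N}$ and finite sets $p^{(j)}\subset\mathbb{R}[t]$ and $q^{(j)}\subset\mathbb{R}[t]$, $j=1,\dots,w$, such that $$f^\star=\min_{t\in Q}g(t),\qquad Q=\bigcup_{j=1}^w S(p^{(j)},q^{(j)}),$$ and the following conditions hold for every $j$: 1. Each polynomial in $p^{(j)}$ has only simple roots. 2. Any two distinct polynomials in $p^{(j)}$ have no common root. Moreover, (for these $p^{(j)},q^{(j)}$) there exists $K\in\mathbb{N}$ such that for all $k\ge K$, $$f^\star=\min_{j=1,\dots,w}\rho_k(g,p^{(j)},q^{(j)}).$$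
   Context: A set in $\mathbb{R}^n$ is semi-algebraic if it is a finite union of sets of the form $\{x\in\mathbb{R}^n: p_1(x)>0,\dots,p_m(x)>0,\ q_1(x)=\dots=q_l(x)=0\}$ with polynomials $p_i,q_j$. $\overline{A}$ is the closure of $A$ in the usual topology. Roots are complex roots, and a root is simple if it has multiplicity $1$. $\Sigma[t]$ is the cone of sums of squares of polynomials in $\mathbb{R}[t]$. For $g\in\mathbb{R}[t]$, $p=\{p_1,\dots,p_m\}\subset\mathbb{R}[t]$, $q=\{q_1,\dots,q_l\}\subset\mathbb{R}[t]$ and $k\in\mathbb{N}$, define $$S(p,q)=\{t\in\mathbb{R}: p_1(t)\ge 0,\dots,p_m(t)\ge 0,\ q_1(t)=\dots=q_l(t)=0\},$$ $$T_k(p,q)[t]=\Big\{\sum_{\alpha\in\{0,1\}^m}\sigma_\alpha p^\alpha+\sum_{j=1}^l\psi_jq_j : \sigma_\alpha\in\Sigma[t],\ \psi_j\in\mathbb{R}[t],\ \deg(\sigma_\alpha p^\alpha)\le 2k,\ \deg(\psi_jq_j)\le 2k\Big\},$$ $$\rho_k(g,p,q)=\sup\{\lambda\in\mathbb{R}: g-\lambda\in T_k(p,q)[t]\},$$ where $p^\alpha=p_1^{\alpha_1}\cdots p_m^{\alpha_m}$; the supremum is taken in $\mathbb{R}\cup\{\pm\infty\}$. *)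

theory Defs
  imports "HOL-Analysis.Analysis" "HOL-Computational_Algebra.Polynomial"
begin

text \<open>
  Polynomials in \<open>n\<close> variables occur only through their values, so they are given as polynomial
  functions. \<open>real_polynomial_function\<close> is the closure of the bounded linear functionals and the
  constants under sums and products; on \<open>real ^ 'n\<close> the linear functionals are the linear forms in
  the coordinates, so these are exactly the functions defined by real polynomials in the
  coordinates.
\<close>

definition basic_semialgebraic :: "(real ^ 'n) set \<Rightarrow> bool" where
  "basic_semialgebraic B \<longleftrightarrow>
     (\<exists>P Q. finite P \<and> finite Q \<and>
        (\<forall>p\<in>P. real_polynomial_function p) \<and> (\<forall>q\<in>Q. real_polynomial_function q) \<and>
        B = {x. (\<forall>p\<in>P. p x > 0) \<and> (\<forall>q\<in>Q. q x = 0)})"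

definition semialgebraic :: "(real ^ 'n) set \<Rightarrow> bool" where
  "semialgebraic S \<longleftrightarrow> (\<exists>\<B>. finite \<B> \<and> (\<forall>B\<in>\<B>. basic_semialgebraic B) \<and> S = \<Union>\<B>)"

abbreviation cpoly :: "real poly \<Rightarrow> complex poly" where
  "cpoly p \<equiv> map_poly complex_of_real p"

text \<open>
  The zero polynomial is excluded: it vanishes everywhere with infinite multiplicity, while the
  value of \<open>order\<close> on it is unspecified.
\<close>

definition only_simple_roots :: "real poly \<Rightarrow> bool" where
  "only_simple_roots p \<longleftrightarrow>
     p \<noteq> 0 \<and> (\<forall>z. poly (cpoly p) z = 0 \<longrightarrow> order z (cpoly p) = 1)"

definition no_common_root :: "real poly \<Rightarrow> real poly \<Rightarrow> bool" where
  "no_common_root p q \<longleftrightarrow> \<not> (\<exists>z. poly (cpoly p) z = 0 \<and> poly (cpoly q) z = 0)"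

definition sos :: "real poly set" where
  "sos = {\<Sum>i<N. (h i)\<^sup>2 | (h :: nat \<Rightarrow> real poly) (N :: nat). True}"

definition feasible_set :: "real poly set \<Rightarrow> real poly set \<Rightarrow> real set" where
  "feasible_set p q = {t. (\<forall>r\<in>p. poly r t \<ge> 0) \<and> (\<forall>r\<in>q. poly r t = 0)}"

text \<open>
  For finite \<open>p\<close>, an exponent \<open>\<alpha> \<in> {0,1}\<^sup>m\<close> is the subset \<open>A\<close> of \<open>p\<close> on which it equals \<open>1\<close>,
  and \<open>p\<^sup>\<alpha>\<close> is the product \<open>\<Prod>A\<close>. The zero polynomial has \<open>degree\<close> \<open>0\<close>, hence meets every
  degree bound, as it does under the convention that its degree is minus infinity.
\<close>

definition truncated_preordering ::
    "nat \<Rightarrow> real poly set \<Rightarrow> real poly set \<Rightarrow> real poly set" where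
  "truncated_preordering k p q =
     {(\<Sum>A\<in>Pow p. \<sigma> A * \<Prod>A) + (\<Sum>r\<in>q. \<psi> r * r) | \<sigma> \<psi>.
        (\<forall>A\<in>Pow p. \<sigma> A \<in> sos \<and> degree (\<sigma> A * \<Prod>A) \<le> 2 * k) \<and>
        (\<forall>r\<in>q. degree (\<psi> r * r) \<le> 2 * k)}"

definition rho :: "nat \<Rightarrow> real poly \<Rightarrow> real poly set \<Rightarrow> real poly set \<Rightarrow> ereal" where
  "rho k g p q = (SUP c\<in>{c. g - [:c:] \<in> truncated_preordering k p q}. ereal c)"

end

theory Submission imports Defs begin

text \<open>
  The image \<open>f ` S\<close> is a semialgebraic subset of the line by the Tarski-Seidenberg theorem. Being
  bounded, it is a finite union of points and bounded intervals, so its closure \<open>Q\<close> is a finite union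
  of intervals \<open>{a..b}\<close> with \<open>a \<le> b\<close>. For \<open>a < b\<close> take the two constraints \<open>t - a \<ge> 0\<close> and
  \<open>b - t \<ge> 0\<close>, which are linear with distinct roots; for \<open>a = b\<close> take the equation \<open>t - a = 0\<close>. Since
  \<open>t - a\<close> is itself one of the constraints, it lies in every truncated preordering with \<open>k \<ge> 1\<close>, and
  the relaxation over this interval has the exact value \<open>a\<close> (\<open>rho_interval\<close>). The minimum of \<open>Q\<close> is
  the smallest left end, so the relaxations are exact from \<open>K = 1\<close> on.

  The substance is the projection theorem, proved by the method of Cohen and Hoermander in a
  semantic form. A set is called sign determined if membership depends only on the signs of finitely
  many polynomial functions. To project it along a direction, view these functions as univariate
  polynomials whose coefficients depend on a parameter, and compare their sign diagrams at two
  parameters: the diagrams agree if an increasing bijection of the line preserves all signs. The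
  claim is that finitely many polynomial functions of the parameter decide, by their signs, which
  diagrams agree (\<open>diagram_determined_poly_families\<close>). A polynomial \<open>q\<close> of top degree is
  replaced by its derivative and its remainders modulo the derivative and the others; the remainders
  give the signs of \<open>q\<close> at the roots of all these, and between these roots \<open>q\<close> is monotone, so that
  its signs are forced (\<open>extend_sign_isomorphism\<close>). Where the leading coefficient of \<open>q\<close> vanishes, \<open>q\<close> is
  replaced by its truncation instead. The degrees decrease, and for constant polynomials the claim
  is trivial.
\<close>

section \<open>Matching the signs of real polynomials by an order isomorphism\<close>

text \<open>
  This turns a matching of finitely many roots into a change of variable on the whole line: the
  extension is affine beyond the last but one point, so each new point on the right costs one more
  slope.
\<close>

lemma finite_strict_mono_extension:
  fixes h :: "real \<Rightarrow> real"
  assumes "finite C" "\<And>x y. x \<in> C \<Longrightarrow> y \<in> C \<Longrightarrow> x < y \<Longrightarrow> h x < h y"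
  shows "\<exists>\<psi>. strict_mono \<psi> \<and> surj \<psi> \<and> (\<forall>c\<in>C. \<psi> c = h c)"
  using assms
proof (induction C rule: finite_linorder_max_induct)
  case empty
  have "strict_mono (\<lambda>x::real. x)" by (simp add: strict_mono_def)
  then show ?case by (metis surj_id id_apply strict_mono_def empty_iff)
next
  case (insert c C)
  then obtain \<psi> where \<psi>: "strict_mono \<psi>" "surj \<psi>" "\<forall>x\<in>C. \<psi> x = h x" by blast
  show ?case
  proof (cases "C = {}")
    case True
    have "strict_mono (\<lambda>x. x + (h c - c))" by (simp add: strict_mono_def)
    moreover have "surj (\<lambda>x. x + (h c - c))"
      by (rule surjI[where f = "\<lambda>x. x - (h c - c)"]) simp
    ultimately show ?thesis using True by (intro exI[of _ "\<lambda>x. x + (h c - c)"]) simp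
  next
    case False
    define m where "m = Max C"
    have m: "m \<in> C" "\<And>x. x \<in> C \<Longrightarrow> x \<le> m" "m < c"
      using False insert by (auto simp: m_def)
    have hm: "h m < h c" using insert.prems m by blast
    define s where "s = (h c - h m) / (c - m)"
    have s: "s > 0" using hm m by (simp add: s_def)
    define \<theta> where "\<theta> x = (if x \<le> m then \<psi> x else h m + (x - m) * s)" for x
    have \<psi>m: "\<psi> m = h m" using \<psi> m by blast
    have "strict_mono \<theta>"
    proof (rule strict_monoI)
      fix x y :: real assume xy: "x < y"
      consider "y \<le> m" | "x \<le> m" "m < y" | "m < x" using xy by linarith
      then show "\<theta> x < \<theta> y"
      proof cases
        case 1 then show ?thesis using xy \<psi>(1) by (simp add: \<theta>_def strict_mono_def)
      next
        case 2
        have "\<psi> x \<le> h m" using \<psi>(1) 2 \<psi>m by (metis strict_mono_less_eq)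
        moreover have "0 < (y - m) * s" using 2 s by simp
        ultimately show ?thesis using 2 unfolding \<theta>_def by simp
      next
        case 3 then show ?thesis using xy s by (simp add: \<theta>_def)
      qed
    qed
    moreover have "surj \<theta>"
    proof -
      have "\<exists>x. \<theta> x = y" for y
      proof (cases "y \<le> h m")
        case True
        obtain x where "\<psi> x = y" using \<psi>(2) by (metis surjD)
        then have "x \<le> m" using True \<psi>(1) \<psi>m by (metis strict_mono_less_eq)
        then show ?thesis using \<open>\<psi> x = y\<close> by (auto simp: \<theta>_def)
      next
        case False
        then have "m + (y - h m) / s > m" using s by simp
        then have "\<theta> (m + (y - h m) / s) = y" using s by (simp add: \<theta>_def)
        then show ?thesis ..
      qed
      then show ?thesis by (metis surj_def)
    qed
    moreover have "\<theta> x = h x" if "x \<in> insert c C" for x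
      using that m \<psi> by (auto simp: \<theta>_def s_def)
    ultimately show ?thesis by blast
  qed
qed

lemma poly_root_between:
  fixes p :: "real poly"
  assumes "a < b" "sgn (poly p a) = - sgn (poly p b)" "poly p b \<noteq> 0"
  shows "\<exists>x. a < x \<and> x < b \<and> poly p x = 0"
proof (cases "poly p b > 0")
  case True
  then have "poly p a < 0" using assms(2) by (simp add: sgn_if split: if_splits)
  then show ?thesis using poly_IVT_pos assms(1) True by blast
next
  case False
  then have "poly p b < 0" using assms(3) by simp
  moreover have "poly p a > 0" using assms(2) calculation by (simp add: sgn_if split: if_splits)
  ultimately show ?thesis using poly_IVT_neg assms(1) by blast
qed

lemma poly_sgn_eq_of_no_root:
  fixes p :: "real poly"
  assumes "\<And>x. min a b \<le> x \<Longrightarrow> x \<le> max a b \<Longrightarrow> poly p x \<noteq> 0"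
  shows "sgn (poly p a) = sgn (poly p b)"
proof (rule ccontr)
  assume neq: "sgn (poly p a) \<noteq> sgn (poly p b)"
  have nz: "poly p a \<noteq> 0" "poly p b \<noteq> 0" using assms by auto
  then have op: "sgn (poly p a) = - sgn (poly p b)" "sgn (poly p b) = - sgn (poly p a)"
    using neq by (auto simp: sgn_if split: if_splits)
  consider "a < b" | "b < a" using neq by fastforce
  then show False
  proof cases
    case 1 then show False using poly_root_between[OF 1 op(1) nz(2)] assms by force
  next
    case 2 then show False using poly_root_between[OF 2 op(2) nz(1)] assms by force
  qed
qed

text \<open>
  A derivative of constant sign \<open>s\<close> makes \<open>q\<close> strictly monotone in the direction \<open>s\<close>. Carrying \<open>s\<close> along
  treats increasing and decreasing polynomials together.
\<close>

lemma sgn_poly_diff: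
  fixes q :: "real poly"
  assumes "x \<le> u" "u < v" "v \<le> z" "\<And>\<eta>. x < \<eta> \<Longrightarrow> \<eta> < z \<Longrightarrow> sgn (poly (pderiv q) \<eta>) = s"
  shows "sgn (poly q v - poly q u) = s"
proof -
  obtain \<xi> where "u < \<xi>" "\<xi> < v" "poly q v - poly q u = (v - u) * poly (pderiv q) \<xi>"
    using poly_MVT[OF assms(2)] by blast
  then show ?thesis using assms by (simp add: sgn_mult)
qed

text \<open>
  Two polynomials that are monotone in the same direction and have the same signs at the ends of
  their intervals need not have the same signs inside, since a root may be passed at different
  places. If one of them has no root inside, its end values do not have strictly opposite signs, and
  then monotonicity forces the inner sign of both.
\<close>

lemma sgn_poly_in_gap:
  fixes q q' :: "real poly"
  assumes "x < y" "y < z" "x' < y'" "y' < z'"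
    and d: "\<And>\<eta>. x < \<eta> \<Longrightarrow> \<eta> < z \<Longrightarrow> sgn (poly (pderiv q) \<eta>) = s"
    and d': "\<And>\<eta>. x' < \<eta> \<Longrightarrow> \<eta> < z' \<Longrightarrow> sgn (poly (pderiv q') \<eta>) = s"
    and "s = 1 \<or> s = -1"
    and ex: "sgn (poly q x) = sgn (poly q' x')" and ez: "sgn (poly q z) = sgn (poly q' z')"
    and nr: "\<And>\<eta>. x < \<eta> \<Longrightarrow> \<eta> < z \<Longrightarrow> poly q \<eta> \<noteq> 0"
  shows "sgn (poly q y) = sgn (poly q' y')"
proof -
  have 1: "sgn (poly q y - poly q x) = s" "sgn (poly q z - poly q y) = s"
    using sgn_poly_diff[of x x y z q s] sgn_poly_diff[of x y z z q s] assms by auto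
  have 2: "sgn (poly q' y' - poly q' x') = s" "sgn (poly q' z' - poly q' y') = s"
    using sgn_poly_diff[of x' x' y' z' q' s] sgn_poly_diff[of x' y' z' z' q' s] assms by auto
  have "\<not> (poly q x < 0 \<and> poly q z > 0)" "\<not> (poly q x > 0 \<and> poly q z < 0)"
    using poly_IVT_pos[of x z q] poly_IVT_neg[of x z q] nr assms(1,2) by force+
  then show ?thesis using 1 2 ex ez \<open>s = 1 \<or> s = -1\<close>
    by (auto simp: sgn_if split: if_splits)
qed

lemma sgn_poly_at_top:
  fixes p :: "real poly"
  shows "\<exists>n. \<forall>x\<ge>n. sgn (poly p x) = sgn (lead_coeff p)"
proof -
  consider "p = 0" | "lead_coeff p > 0" | "lead_coeff (-p) > 0"
    by (metis lead_coeff_minus leading_coeff_0_iff neg_0_less_iff_less linorder_neqE_linordered_idom)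
  then show ?thesis
  proof cases
    case 2
    then obtain n where "\<forall>x\<ge>n. lead_coeff p \<le> poly p x" using poly_pinfty_gt_lc by blast
    then show ?thesis using 2 by (intro exI[of _ n]) (force simp: sgn_if)
  next
    case 3
    then obtain n where n: "\<forall>x\<ge>n. lead_coeff (-p) \<le> poly (-p) x" using poly_pinfty_gt_lc by blast
    have "sgn (poly p x) = sgn (lead_coeff p)" if "x \<ge> n" for x
      using n that 3 by (simp add: sgn_if) (metis less_le_trans order.asym neg_0_less_iff_less neg_le_iff_le)
    then show ?thesis by blast
  qed simp
qed

lemma sgn_poly_at_bot:
  fixes p :: "real poly"
  shows "\<exists>n. \<forall>x\<le>n. sgn (poly p x) = sgn (lead_coeff p) * (-1) ^ degree p"
proof -
  define r where "r = pcompose p [:0, -1:]"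
  have lc: "lead_coeff r = lead_coeff p * (-1) ^ degree p"
    unfolding r_def by (subst lead_coeff_comp) simp_all
  obtain n where n: "\<forall>x\<ge>n. sgn (poly r x) = sgn (lead_coeff r)" using sgn_poly_at_top by blast
  have "sgn (poly p x) = sgn (lead_coeff p) * (-1) ^ degree p" if "x \<le> -n" for x
  proof -
    have "poly r (-x) = poly p x" by (simp add: r_def poly_pcompose)
    then have "sgn (poly p x) = sgn (lead_coeff r)" using n that by (metis le_minus_iff)
    also have "\<dots> = sgn (lead_coeff p) * (-1) ^ degree p"
      by (simp add: lc sgn_mult power_sgn[symmetric])
    finally show ?thesis .
  qed
  then show ?thesis by blast
qed

text \<open>
  This is the analytic core. Let \<open>W\<close> consist of the roots of the given polynomials, among them the
  roots of \<open>pderiv q\<close>, and of two points beyond which the leading terms decide the signs of \<open>q\<close> and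
  \<open>q'\<close>. Between neighbouring points of \<open>W\<close> both \<open>q\<close> and \<open>q'\<close> are strictly monotone in the same
  direction, and they have the same signs at corresponding points of \<open>W\<close>. Hence each gap contains
  at most one root of \<open>q\<close>, and then the corresponding gap contains a root of \<open>q'\<close>. Moving \<open>\<phi>\<close> inside
  the gaps so that it matches these roots leaves the signs of the old polynomials unchanged, because
  they have no roots there.
\<close>

lemma extend_sign_isomorphism:
  fixes p p' :: "'i \<Rightarrow> real poly" and q q' :: "real poly"
  assumes I: "finite I" and \<phi>: "strict_mono \<phi>" "surj \<phi>"
    and sgn_p: "\<And>i y. i \<in> I \<Longrightarrow> sgn (poly (p i) y) = sgn (poly (p' i) (\<phi> y))"
    and j: "j \<in> I" "p j = pderiv q" "p' j = pderiv q'"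
    and deg: "degree q = degree q'" "degree q > 0"
    and lead: "sgn (lead_coeff q) = sgn (lead_coeff q')"
    and sgn_q: "\<And>i y. i \<in> I \<Longrightarrow> p i \<noteq> 0 \<Longrightarrow> poly (p i) y = 0 \<Longrightarrow>
                  sgn (poly q y) = sgn (poly q' (\<phi> y))"
  shows "\<exists>\<psi>. strict_mono \<psi> \<and> surj \<psi> \<and>
           (\<forall>i\<in>I. \<forall>y. sgn (poly (p i) y) = sgn (poly (p' i) (\<psi> y))) \<and>
           (\<forall>y. sgn (poly q y) = sgn (poly q' (\<psi> y)))"
proof -
  have less: "\<phi> x < \<phi> y \<longleftrightarrow> x < y" for x y using \<phi>(1) by (rule strict_mono_less)
  have le: "\<phi> x \<le> \<phi> y \<longleftrightarrow> x \<le> y" for x y using \<phi>(1) by (rule strict_mono_less_eq)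
  have dq0: "pderiv q \<noteq> 0" using deg(2) by (simp add: pderiv_eq_0_iff)
  have q0: "q \<noteq> 0" using deg(2) by auto
  define Z where "Z = (\<Union>i\<in>{i\<in>I. p i \<noteq> 0}. {y. poly (p i) y = 0})"
  have finZ: "finite Z" unfolding Z_def using I by (auto intro: poly_roots_finite)
  obtain M0 where M0: "\<And>y. y \<ge> M0 \<Longrightarrow> sgn (poly q y) = sgn (lead_coeff q)"
      "\<And>y. y \<ge> \<phi> M0 \<Longrightarrow> sgn (poly q' y) = sgn (lead_coeff q)"
  proof -
    obtain n n' where n: "\<forall>x\<ge>n. sgn (poly q x) = sgn (lead_coeff q)"
        "\<forall>x\<ge>n'. sgn (poly q' x) = sgn (lead_coeff q')" using sgn_poly_at_top by metis
    obtain k where k: "\<phi> k = n'" using \<phi>(2) by (metis surjD)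
    have "\<phi> (max n k) \<ge> n'" using k le[of k "max n k"] by simp
    then show ?thesis using n lead by (intro that[of "max n k"]) auto
  qed
  obtain m0 where m0: "\<And>y. y \<le> m0 \<Longrightarrow> sgn (poly q y) = sgn (lead_coeff q) * (-1) ^ degree q"
      "\<And>y. y \<le> \<phi> m0 \<Longrightarrow> sgn (poly q' y) = sgn (lead_coeff q) * (-1) ^ degree q"
  proof -
    obtain n n' where n: "\<forall>x\<le>n. sgn (poly q x) = sgn (lead_coeff q) * (-1) ^ degree q"
        "\<forall>x\<le>n'. sgn (poly q' x) = sgn (lead_coeff q') * (-1) ^ degree q'"
      using sgn_poly_at_bot by metis
    obtain k where k: "\<phi> k = n'" using \<phi>(2) by (metis surjD)
    have "\<phi> (min n k) \<le> n'" using k le[of "min n k" k] by simp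
    then show ?thesis using n lead deg by (intro that[of "min n k"]) auto
  qed
  define W where "W = insert m0 (insert M0 Z)"
  have finW: "finite W" using finZ by (simp add: W_def)
  have sgnW: "sgn (poly q w) = sgn (poly q' (\<phi> w))" if "w \<in> W" for w
    using that sgn_q M0 m0 by (force simp: W_def Z_def)
  have ZW: "y \<in> W" if "i \<in> I" "p i \<noteq> 0" "poly (p i) y = 0" for i y
    using that by (auto simp: W_def Z_def)
  have dW: "y \<in> W" if "poly (pderiv q) y = 0" for y
    using ZW[OF j(1)] j dq0 that by simp
  have root_bounds: "m0 < c" "c < M0" if "poly q c = 0" for c
    using that M0(1)[of c] m0(1)[of c] q0 by (auto simp: not_less[symmetric] sgn_zero_iff)

  \<comment> \<open>each root of \<open>q\<close> outside \<open>W\<close> has a partner in the corresponding gap\<close>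
  have match: "\<exists>c'. poly q' c' = 0 \<and> (\<forall>w\<in>W. (w < c \<longrightarrow> \<phi> w < c') \<and> (c < w \<longrightarrow> c' < \<phi> w))"
    if c: "poly q c = 0" "c \<notin> W" for c
  proof -
    define a where "a = Max {w\<in>W. w < c}"
    define b where "b = Min {w\<in>W. c < w}"
    have "finite {w\<in>W. w < c}" "{w\<in>W. w < c} \<noteq> {}" "finite {w\<in>W. c < w}" "{w\<in>W. c < w} \<noteq> {}"
      using finW root_bounds[OF c(1)] by (auto simp: W_def)
    note ab = Max_in[OF this(1,2), folded a_def] Max_ge[OF this(1), folded a_def]
      Min_in[OF this(3,4), folded b_def] Min_le[OF this(3), folded b_def]
    have gap: "w \<le> a \<or> b \<le> w" if "w \<in> W" for w
      using ab that c(2) by (cases "w < c"; cases "c < w") auto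
    define s where "s = sgn (poly (pderiv q) c)"
    have s: "s = 1 \<or> s = -1" using c dW by (auto simp: s_def sgn_if)
    have sd: "sgn (poly (pderiv q) \<eta>) = s" if "a < \<eta>" "\<eta> < b" for \<eta>
      unfolding s_def
      by (rule poly_sgn_eq_of_no_root) (use gap dW that ab in \<open>force simp: min_def max_def split: if_splits\<close>)
    have "sgn (poly q c - poly q a) = s" "sgn (poly q b - poly q c) = s"
      using sgn_poly_diff[of a a c b q s] sgn_poly_diff[of a c b b q s] ab sd by auto
    then have "sgn (poly q a) = -s" "sgn (poly q b) = s"
      using c by (auto simp: sgn_minus)
    then have "sgn (poly q' (\<phi> a)) = -s" "sgn (poly q' (\<phi> b)) = s"
      using sgnW ab by auto
    moreover have "\<phi> a < \<phi> b" using ab less by auto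
    ultimately obtain c' where c': "\<phi> a < c'" "c' < \<phi> b" "poly q' c' = 0"
      using poly_root_between[of "\<phi> a" "\<phi> b" q'] s by fastforce
    have "(w < c \<longrightarrow> \<phi> w < c') \<and> (c < w \<longrightarrow> c' < \<phi> w)" if "w \<in> W" for w
      using ab that c' le[of w a] le[of b w] by force
    then show ?thesis using c' by blast
  qed
  define h where "h c = (if c \<in> W then \<phi> c else
     (SOME c'. poly q' c' = 0 \<and> (\<forall>w\<in>W. (w < c \<longrightarrow> \<phi> w < c') \<and> (c < w \<longrightarrow> c' < \<phi> w))))" for c
  have hW: "h c = \<phi> c" if "c \<in> W" for c using that by (simp add: h_def)
  have hR: "poly q' (h c) = 0" "\<And>w. w \<in> W \<Longrightarrow> w < c \<Longrightarrow> h w < h c"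
    "\<And>w. w \<in> W \<Longrightarrow> c < w \<Longrightarrow> h c < h w" if "poly q c = 0" "c \<notin> W" for c
    using someI_ex[OF match[OF that]] that hW by (auto simp: h_def)
  define C where "C = W \<union> {y. poly q y = 0}"
  have finC: "finite C" using finW q0 by (simp add: C_def poly_roots_finite)
  have "h x < h y" if xy: "x \<in> C" "y \<in> C" "x < y" for x y
  proof -
    consider "x \<in> W" "y \<in> W" | "x \<in> W" "y \<notin> W" "poly q y = 0" | "x \<notin> W" "y \<in> W" "poly q x = 0"
      | "x \<notin> W" "y \<notin> W" "poly q x = 0" "poly q y = 0" using xy by (auto simp: C_def)
    then show ?thesis
    proof cases
      case 4
      \<comment> \<open>Rolle: a point of \<open>W\<close> separates the two roots, hence also their partners\<close>
      obtain w where "x < w" "w < y" "poly (pderiv q) w = 0"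
        using poly_MVT[OF xy(3), of q] 4 xy(3) by auto
      then show ?thesis using dW hR 4 by (meson order.strict_trans)
    qed (use xy less hW hR in auto)
  qed
  then obtain \<psi> where \<psi>: "strict_mono \<psi>" "surj \<psi>" "\<And>c. c \<in> C \<Longrightarrow> \<psi> c = h c"
    using finite_strict_mono_extension[OF finC] by metis
  have \<psi>W: "\<psi> w = \<phi> w" if "w \<in> W" for w using \<psi>(3) hW that by (simp add: C_def)
  have \<psi>less: "\<psi> x < \<psi> y \<longleftrightarrow> x < y" for x y using \<psi>(1) by (rule strict_mono_less)
  have \<psi>p: "sgn (poly (p i) y) = sgn (poly (p' i) (\<psi> y))" if i: "i \<in> I" for i y
  proof (cases "y \<in> W \<or> p i = 0")
    case True
    then show ?thesis
    proof
      assume "p i = 0"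
      obtain u where "\<psi> y = \<phi> u" using \<phi>(2) by (metis surjD)
      then show ?thesis using sgn_p[OF i] \<open>p i = 0\<close> by (metis poly_0)
    qed (use sgn_p i \<psi>W in auto)
  next
    case False
    \<comment> \<open>a root between \<open>\<phi> y\<close> and \<open>\<psi> y\<close> would lie in \<open>\<phi> ` W\<close>, where both maps agree\<close>
    have "sgn (poly (p' i) (\<phi> y)) = sgn (poly (p' i) (\<psi> y))"
    proof (rule poly_sgn_eq_of_no_root)
      fix t assume t: "min (\<phi> y) (\<psi> y) \<le> t" "t \<le> max (\<phi> y) (\<psi> y)"
      obtain u where u: "t = \<phi> u" using \<phi>(2) by (metis surjD)
      show "poly (p' i) t \<noteq> 0"
      proof
        assume "poly (p' i) t = 0"
        then have "poly (p i) u = 0" using sgn_p[OF i, of u] u by (simp add: sgn_zero_iff)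
        then have "u \<in> W" using ZW i False by blast
        then have "\<psi> u = t" "u \<noteq> y" using \<psi>W u False by auto
        then show False using t u less[of u y] less[of y u] \<psi>less[of u y] \<psi>less[of y u]
          by (cases "u < y") (auto simp: min_def max_def split: if_splits)
      qed
    qed
    then show ?thesis using sgn_p[OF i] by simp
  qed
  have "sgn (poly q y) = sgn (poly q' (\<psi> y))" for y
  proof -
    consider "y \<in> C" | "y \<ge> M0" | "y \<le> m0" | "y \<notin> C" "m0 < y" "y < M0" by linarith
    then show ?thesis
    proof cases
      case 1
      then show ?thesis using \<psi>(3) hW hR sgnW by (cases "y \<in> W") (auto simp: C_def)
    next
      case 2
      then have "\<psi> y \<ge> \<phi> M0" using \<psi>W[of M0] \<psi>less[of y M0] by (simp add: W_def)
      then show ?thesis using M0 2 by simp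
    next
      case 3
      then have "\<psi> y \<le> \<phi> m0" using \<psi>W[of m0] \<psi>less[of m0 y] by (simp add: W_def)
      then show ?thesis using m0 3 by simp
    next
      case 4
      define x where "x = Max {w\<in>C. w < y}"
      define z where "z = Min {w\<in>C. y < w}"
      have "finite {w\<in>C. w < y}" "{w\<in>C. w < y} \<noteq> {}" "finite {w\<in>C. y < w}" "{w\<in>C. y < w} \<noteq> {}"
        using finC 4 by (auto simp: W_def C_def)
      note xz = Max_in[OF this(1,2), folded x_def] Max_ge[OF this(1), folded x_def]
        Min_in[OF this(3,4), folded z_def] Min_le[OF this(3), folded z_def]
      have gap: "w \<notin> C" if "x < w" "w < z" for w
        using xz that 4(1) by (cases "w < y"; cases "y < w") force+
      have CW: "W \<subseteq> C" "\<And>t. poly q t = 0 \<Longrightarrow> t \<in> C" by (auto simp: C_def)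
      define s where "s = sgn (poly (pderiv q) y)"
      have s: "s = 1 \<or> s = -1" using 4 dW CW by (auto simp: s_def sgn_if)
      have sd: "sgn (poly (pderiv q) \<eta>) = s" if "x < \<eta>" "\<eta> < z" for \<eta>
        unfolding s_def
      proof (rule poly_sgn_eq_of_no_root)
        fix t assume "min \<eta> y \<le> t" "t \<le> max \<eta> y"
        then have "x < t" "t < z" using that xz by (auto simp: min_def max_def split: if_splits)
        then show "poly (pderiv q) t \<noteq> 0" using gap dW CW by blast
      qed
      have onC: "sgn (poly q t) = sgn (poly q' (\<psi> t))" if "t \<in> C" for t
        using that \<psi>(3) hW hR sgnW by (cases "t \<in> W") (auto simp: C_def)
      \<comment> \<open>\<open>x\<close> and \<open>z\<close> are neighbours in \<open>C\<close>, which contains all roots of \<open>q\<close>\<close>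
      show ?thesis
      proof (rule sgn_poly_in_gap[where x = x and z = z and x' = "\<psi> x" and z' = "\<psi> z" and s = s])
        fix \<eta> assume \<eta>: "\<psi> x < \<eta>" "\<eta> < \<psi> z"
        obtain u where u: "\<eta> = \<psi> u" using \<psi>(2) by (metis surjD)
        then have "x < u" "u < z" using \<eta> \<psi>less by auto
        then show "sgn (poly (pderiv q') \<eta>) = s" using sd \<psi>p[OF j(1), of u] j u by simp
      next
        fix \<eta> assume "x < \<eta>" "\<eta> < z"
        then show "poly q \<eta> \<noteq> 0" using gap CW(2) by blast
      qed (use xz sd s onC \<psi>less in auto)
    qed
  qed
  then show ?thesis using \<psi> \<psi>p by blast
qed

section \<open>Sign diagrams of polynomials with parameters\<close>

text \<open>
  A polynomial in one more variable whose coefficients are polynomial functions of the parameter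
  \<open>x\<close>. The bound \<open>d\<close> is a formal degree: for special \<open>x\<close> the actual degree of \<open>P x\<close> may drop.
\<close>

definition poly_family :: "nat \<Rightarrow> ('x::real_normed_vector \<Rightarrow> real poly) \<Rightarrow> bool" where
  "poly_family d P \<longleftrightarrow>
     (\<forall>x. degree (P x) \<le> d) \<and> (\<forall>i. real_polynomial_function (\<lambda>x. coeff (P x) i))"

definition same_signs :: "('x \<Rightarrow> real) set \<Rightarrow> 'x \<Rightarrow> 'x \<Rightarrow> bool" where
  "same_signs G x x' \<longleftrightarrow> (\<forall>a\<in>G. sgn (a x) = sgn (a x'))"

text \<open>
  The sign diagram of a family at \<open>x\<close> records how the roots of its members are ordered and which signs
  occur at them and between them. Two diagrams coincide exactly when an order isomorphism of the
  line carries one onto the other. This form avoids tables of roots, and a change of the diagram is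
  a change of \<open>\<phi>\<close>.
\<close>

definition sign_isomorphic :: "('x \<Rightarrow> real poly) set \<Rightarrow> 'x \<Rightarrow> 'x \<Rightarrow> bool" where
  "sign_isomorphic F x x' \<longleftrightarrow>
     (\<exists>\<phi>. strict_mono \<phi> \<and> surj \<phi> \<and>
        (\<forall>P\<in>F. \<forall>y. sgn (poly (P x) y) = sgn (poly (P x') (\<phi> y))))"

definition diagram_determined :: "('x::real_normed_vector \<Rightarrow> real poly) set \<Rightarrow> bool" where
  "diagram_determined F \<longleftrightarrow>
     (\<exists>G. finite G \<and> (\<forall>a\<in>G. real_polynomial_function a) \<and>
        (\<forall>x x'. same_signs G x x' \<longrightarrow> sign_isomorphic F x x'))"

lemma same_signsD: "same_signs G x x' \<Longrightarrow> a \<in> G \<Longrightarrow> sgn (a x) = sgn (a x')"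
  by (simp add: same_signs_def)

lemma same_signs_sym: "same_signs G x x' \<Longrightarrow> same_signs G x' x"
  by (auto simp: same_signs_def)

lemma same_signs_mono: "same_signs G x x' \<Longrightarrow> H \<subseteq> G \<Longrightarrow> same_signs H x x'"
  by (auto simp: same_signs_def)

lemma poly_family_mono: "poly_family d P \<Longrightarrow> d \<le> e \<Longrightarrow> poly_family e P"
  by (auto simp: poly_family_def intro: order_trans)

lemma poly_family_coeff: "poly_family d P \<Longrightarrow> real_polynomial_function (\<lambda>x. coeff (P x) i)"
  by (simp add: poly_family_def)

lemma poly_family_pderiv:
  assumes "poly_family (Suc d) P" shows "poly_family d (\<lambda>x. pderiv (P x))"
  unfolding poly_family_def
proof (intro conjI allI)
  show "degree (pderiv (P x)) \<le> d" for x
  proof -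
    have "degree (P x) \<le> Suc d" using assms by (simp add: poly_family_def)
    then show ?thesis by (simp add: degree_pderiv)
  qed
  show "real_polynomial_function (\<lambda>x. coeff (pderiv (P x)) i)" for i
    unfolding coeff_pderiv
    by (intro real_polynomial_function.intros poly_family_coeff[OF assms])
qed

lemma poly_family_cutoff:
  assumes "poly_family d P" shows "poly_family e (\<lambda>x. poly_cutoff (Suc e) (P x))"
  unfolding poly_family_def
proof (intro conjI allI)
  show "degree (poly_cutoff (Suc e) (P x)) \<le> e" for x
    by (rule degree_le) (simp add: coeff_poly_cutoff)
  show "real_polynomial_function (\<lambda>x. coeff (poly_cutoff (Suc e) (P x)) i)" for i
    using poly_family_coeff[OF assms, of i]
    by (cases "i < Suc e") (simp_all add: coeff_poly_cutoff real_polynomial_function.intros(2))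
qed

lemma poly_cutoff_eq: "degree p < n \<Longrightarrow> poly_cutoff n p = p"
  by (rule poly_eqI) (auto simp: coeff_poly_cutoff coeff_eq_0)

text \<open>
  Division of \<open>q x\<close> by \<open>p x\<close> with remainder, uniform in \<open>x\<close>: to stay within polynomial functions of
  \<open>x\<close>, each reduction step multiplies by the leading coefficient of \<open>p x\<close> instead of dividing by it.
  The outcome is only meant for parameters at which the degree of \<open>p x\<close> is exactly \<open>Suc e\<close>; one
  remainder is therefore formed for each possible degree. Its use is that at a root of \<open>p x\<close> the
  sign of \<open>q x\<close> is known from the remainder, which has smaller degree.
\<close>

lemma poly_family_pseudo_remainder:
  assumes p: "poly_family d p" and q: "poly_family m q"
  shows "\<exists>R k. poly_family e R \<and>
    (\<forall>x y. degree (p x) = Suc e \<longrightarrow> poly (p x) y = 0 \<longrightarrow>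
       poly (R x) y = coeff (p x) (Suc e) ^ k * poly (q x) y)"
  using q
proof (induction m arbitrary: q)
  case 0
  have "poly_family e q" using 0 by (rule poly_family_mono) simp
  then show ?case by (intro exI[of _ q] exI[of _ 0]) simp
next
  case (Suc m)
  show ?case
  proof (cases "Suc m \<le> e")
    case True
    have "poly_family e q" using Suc.prems True by (rule poly_family_mono)
    then show ?thesis by (intro exI[of _ q] exI[of _ 0]) simp
  next
    case False
    define c where "c x = coeff (p x) (Suc e)" for x
    define b where "b x = coeff (q x) (Suc m)" for x
    \<comment> \<open>cutting off the terms above \<open>Suc e\<close> bounds the degree for all \<open>x\<close> and changes nothing where it matters\<close>
    define t where "t x = poly_cutoff (Suc (Suc e)) (p x)" for x
    have t: "poly_family (Suc e) t" unfolding t_def using p by (rule poly_family_cutoff)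
    define q1 where "q1 x = smult (c x) (q x) - smult (b x) (monom 1 (m - e) * t x)" for x
    have coeff_q1: "coeff (q1 x) i =
        c x * coeff (q x) i - b x * (if i < m - e then 0 else coeff (t x) (i - (m - e)))" for x i
      by (simp add: q1_def coeff_monom_mult)
    have "poly_family m q1"
      unfolding poly_family_def
    proof (intro conjI allI)
      fix x
      show "degree (q1 x) \<le> m"
      proof (rule degree_le, intro allI impI)
        fix i assume i: "m < i"
        have ct: "coeff (t x) j = (if j \<le> Suc e then coeff (p x) j else 0)" for j
          by (simp add: t_def coeff_poly_cutoff less_Suc_eq_le)
        show "coeff (q1 x) i = 0"
        proof (cases "i = Suc m")
          case True
          then show ?thesis using False by (simp add: coeff_q1 ct c_def b_def Suc_diff_le)
        next
          case False2: False
          have "degree (q x) < i" using Suc.prems i False2 unfolding poly_family_def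
            by (metis Suc_lessI le_less_trans)
          moreover have "i - (m - e) > Suc e" using i False2 False by linarith
          ultimately show ?thesis by (simp add: coeff_q1 ct coeff_eq_0)
        qed
      qed
    next
      fix i
      have "real_polynomial_function (\<lambda>x. if i < m - e then 0 else coeff (t x) (i - (m - e)))"
        using poly_family_coeff[OF t] by (cases "i < m - e") (auto intro: real_polynomial_function.intros(2))
      then show "real_polynomial_function (\<lambda>x. coeff (q1 x) i)"
        unfolding coeff_q1 c_def b_def
        using poly_family_coeff[OF p] poly_family_coeff[OF Suc.prems]
        by (intro real_polynomial_function_diff real_polynomial_function.intros(4))
    qed
    then obtain R k where R: "poly_family e R"
      "\<forall>x y. degree (p x) = Suc e \<longrightarrow> poly (p x) y = 0 \<longrightarrow>
         poly (R x) y = coeff (p x) (Suc e) ^ k * poly (q1 x) y"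
      using Suc.IH by blast
    have "poly (q1 x) y = c x * poly (q x) y" if "degree (p x) = Suc e" "poly (p x) y = 0" for x y
      using that by (simp add: q1_def t_def poly_cutoff_eq)
    then have "poly (R x) y = coeff (p x) (Suc e) ^ Suc k * poly (q x) y"
      if "degree (p x) = Suc e" "poly (p x) y = 0" for x y
      using R(2) that by (simp add: c_def)
    then show ?thesis using R(1) by blast
  qed
qed

lemma diagram_determined_constant:
  assumes "finite F" "\<And>P. P \<in> F \<Longrightarrow> poly_family 0 P"
  shows "diagram_determined F"
  unfolding diagram_determined_def
proof (intro exI[of _ "(\<lambda>P x. coeff (P x) 0) ` F"] conjI allI impI)
  fix x x' assume G: "same_signs ((\<lambda>P x. coeff (P x) 0) ` F) x x'"
  have "sgn (poly (P x) y) = sgn (poly (P x') (id y))" if "P \<in> F" for P y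
  proof -
    have "degree (P x) = 0" "degree (P x') = 0"
      using assms(2)[OF that] by (auto simp: poly_family_def)
    then have "poly (P x) y = coeff (P x) 0" "poly (P x') (id y) = coeff (P x') 0"
      by (simp_all add: poly_altdef)
    then show ?thesis using G that by (simp add: same_signs_def)
  qed
  then show "sign_isomorphic F x x'"
    unfolding sign_isomorphic_def by (intro exI[of _ id]) (auto simp: strict_mono_def)
qed (use assms in \<open>auto intro: poly_family_coeff\<close>)

text \<open>
  A polynomial \<open>q\<close> of top degree can be dropped. Where its leading coefficient vanishes, \<open>q\<close> equals its
  truncation. Elsewhere its derivative and its pseudo-remainders modulo the other members fix its
  signs at all their roots, and \<open>extend_sign_isomorphism\<close> recovers the diagram. All polynomials that
  replace \<open>q\<close> have smaller degree.
\<close>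

lemma diagram_determined_step:
  fixes q :: "'x::real_normed_vector \<Rightarrow> real poly"
  assumes B: "finite B" "\<And>p. p \<in> B \<Longrightarrow> poly_family (Suc d) p"
    and q: "poly_family (Suc d) q"
    and low: "diagram_determined (insert (\<lambda>x. poly_cutoff (Suc d) (q x)) B)"
    and high: "\<And>E. finite E \<Longrightarrow> (\<And>R. R \<in> E \<Longrightarrow> poly_family d R) \<Longrightarrow> diagram_determined (B \<union> E)"
  shows "diagram_determined (insert q B)"
proof -
  define B' where "B' = insert (\<lambda>x. pderiv (q x)) B"
  have B': "finite B'" "\<And>p. p \<in> B' \<Longrightarrow> poly_family (Suc d) p"
    using B poly_family_mono[OF poly_family_pderiv[OF q], of "Suc d"] by (auto simp: B'_def)
  have "\<exists>R k. poly_family e R \<and>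
      (\<forall>x y. degree (p x) = Suc e \<longrightarrow> poly (p x) y = 0 \<longrightarrow>
         poly (R x) y = coeff (p x) (Suc e) ^ k * poly (q x) y)" if "p \<in> B'" for p e
    using poly_family_pseudo_remainder[OF B'(2)[OF that] q] .
  then obtain R k where R: "\<And>p e. p \<in> B' \<Longrightarrow> poly_family e (R p e)"
    "\<And>p e x y. p \<in> B' \<Longrightarrow> degree (p x) = Suc e \<Longrightarrow> poly (p x) y = 0 \<Longrightarrow>
         poly (R p e x) y = coeff (p x) (Suc e) ^ k p e * poly (q x) y"
    by metis
  define E where "E = insert (\<lambda>x. pderiv (q x)) ((\<lambda>(p, e). R p e) ` (B' \<times> {..d}))"
  have "diagram_determined (B \<union> E)"
  proof (rule high)
    show "finite E" using B' by (simp add: E_def)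
    have "poly_family d (R p e)" if "p \<in> B'" "e \<le> d" for p e
      using poly_family_mono[OF R(1)[OF that(1)] that(2)] .
    then show "poly_family d P" if "P \<in> E" for P
      using poly_family_pderiv[OF q] that by (auto simp: E_def)
  qed
  then obtain G2 where G2: "finite G2" "\<forall>a\<in>G2. real_polynomial_function a"
      "\<And>x x'. same_signs G2 x x' \<Longrightarrow> sign_isomorphic (B \<union> E) x x'"
    unfolding diagram_determined_def by blast
  obtain G1 where G1: "finite G1" "\<forall>a\<in>G1. real_polynomial_function a"
      "\<And>x x'. same_signs G1 x x' \<Longrightarrow>
         sign_isomorphic (insert (\<lambda>x. poly_cutoff (Suc d) (q x)) B) x x'"
    using low unfolding diagram_determined_def by blast
  \<comment> \<open>the signs of all coefficients fix the actual degrees\<close>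
  define G3 where "G3 = (\<lambda>(p, i) x. coeff (p x) i) ` (insert q B' \<times> {..Suc d})"
  have fam: "poly_family (Suc d) p" if "p \<in> insert q B'" for p using that q B' by blast
  have G3: "finite G3" "\<forall>a\<in>G3. real_polynomial_function a"
    using B' fam by (auto simp: G3_def poly_family_def)
  have "sign_isomorphic (insert q B) x x'" if same: "same_signs (G1 \<union> G2 \<union> G3) x x'" for x x'
  proof -
    have cf: "sgn (coeff (p x) i) = sgn (coeff (p x') i)" if "p \<in> insert q B'" for p i
    proof (cases "i \<le> Suc d")
      case True
      then have "(\<lambda>x. coeff (p x) i) \<in> G3" unfolding G3_def using that by force
      then show ?thesis using same_signsD[OF same, of "\<lambda>x. coeff (p x) i"] by simp
    next
      case False
      then have "degree (p x) < i" "degree (p x') < i"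
        using fam[OF that] by (auto simp: poly_family_def not_le intro: le_less_trans)
      then show ?thesis by (simp add: coeff_eq_0)
    qed
    have cf0: "coeff (p x) i = 0 \<longleftrightarrow> coeff (p x') i = 0" if "p \<in> insert q B'" for p i
      using cf[OF that, of i] by (metis sgn_0_0)
    have deg: "degree (p x) = degree (p x')" if "p \<in> insert q B'" for p
      using cf0[OF that] by (simp add: degree_def)
    show ?thesis
    proof (cases "coeff (q x) (Suc d) = 0")
      case True
      have deg_le: "degree (q z) \<le> d" if "coeff (q z) (Suc d) = 0" for z
      proof (rule degree_le, intro allI impI)
        fix i assume "d < i"
        then consider "i = Suc d" | "Suc d < i" by linarith
        then show "coeff (q z) i = 0"
          using that q by cases (auto simp: poly_family_def intro!: coeff_eq_0 intro: le_less_trans)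
      qed
      have "poly_cutoff (Suc d) (q x) = q x" "poly_cutoff (Suc d) (q x') = q x'"
        using deg_le True cf0[of q "Suc d"] by (auto intro!: poly_cutoff_eq simp: less_Suc_eq_le)
      moreover have "sign_isomorphic (insert (\<lambda>x. poly_cutoff (Suc d) (q x)) B) x x'"
        using same by (auto intro!: G1(3) elim: same_signs_mono)
      ultimately show ?thesis by (simp add: sign_isomorphic_def)
    next
      case False
      have "degree (q x) = Suc d"
        using q False by (meson le_antisym le_degree poly_family_def)
      have "sign_isomorphic (B \<union> E) x x'"
        using same by (auto intro!: G2(3) elim: same_signs_mono)
      then obtain \<phi> where \<phi>: "strict_mono \<phi>" "surj \<phi>"
        "\<And>P y. P \<in> B \<union> E \<Longrightarrow> sgn (poly (P x) y) = sgn (poly (P x') (\<phi> y))"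
        unfolding sign_isomorphic_def by blast
      have B'_sub: "B' \<subseteq> B \<union> E" by (auto simp: B'_def E_def)
      \<comment> \<open>the two remainders have equal signs, and so do the leading coefficients they carry\<close>
      have roots: "sgn (poly (q x) y) = sgn (poly (q x') (\<phi> y))"
        if p: "p \<in> B'" "p x \<noteq> 0" "poly (p x) y = 0" for p y
      proof -
        have "degree (p x) \<noteq> 0"
        proof
          assume "degree (p x) = 0"
          then obtain c where "p x = [:c:]" by (metis degree_0_id)
          then show False using p by simp
        qed
        then obtain e where e: "degree (p x) = Suc e" using not0_implies_Suc by blast
        have e': "degree (p x') = Suc e" using deg p e by simp
        have "e \<le> d" using B'(2)[OF p(1)] e by (metis Suc_le_mono poly_family_def)
        then have "R p e \<in> E" using p(1) by (force simp: E_def)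
        then have "sgn (poly (R p e x) y) = sgn (poly (R p e x') (\<phi> y))" using \<phi>(3) by blast
        moreover have "poly (p x') (\<phi> y) = 0"
          using \<phi>(3)[of p y] p B'_sub by (metis sgn_0_0 subsetD)
        ultimately have "sgn (coeff (p x) (Suc e) ^ k p e * poly (q x) y) =
            sgn (coeff (p x') (Suc e) ^ k p e * poly (q x') (\<phi> y))"
          using R(2) p e e' by simp
        moreover have "sgn (coeff (p x) (Suc e)) = sgn (coeff (p x') (Suc e))" using cf p by simp
        moreover have "coeff (p x) (Suc e) \<noteq> 0" using e p(2) by (metis leading_coeff_0_iff)
        moreover have "sgn (a ^ j * b) = sgn a ^ j * sgn b" for a b :: real and j
          by (induction j) (simp_all add: sgn_mult)
        moreover have "coeff (p x') (Suc e) \<noteq> 0" using calculation(3) cf0[of p "Suc e"] p by simp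
        ultimately show ?thesis by (auto simp: sgn_eq_0_iff)
      qed
      have "\<exists>\<psi>. strict_mono \<psi> \<and> surj \<psi> \<and>
          (\<forall>p\<in>B'. \<forall>y. sgn (poly (p x) y) = sgn (poly (p x') (\<psi> y))) \<and>
          (\<forall>y. sgn (poly (q x) y) = sgn (poly (q x') (\<psi> y)))"
      proof (rule extend_sign_isomorphism[where p = "\<lambda>p. p x"
            and p' = "\<lambda>p. p x'" and j = "\<lambda>x. pderiv (q x)"])
        show "sgn (lead_coeff (q x)) = sgn (lead_coeff (q x'))" using cf[of q] deg[of q] by simp
      qed (use B' \<phi> B'_sub deg[of q] \<open>degree (q x) = Suc d\<close> roots in \<open>auto simp: B'_def\<close>)
      then show ?thesis unfolding sign_isomorphic_def B'_def by blast
    qed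
  qed
  then show ?thesis
    unfolding diagram_determined_def using G1 G2 G3 by (intro exI[of _ "G1 \<union> G2 \<union> G3"]) blast
qed

text \<open>
  Induction on the top degree, and for a fixed top degree on the set \<open>H\<close> of members that attain it:
  eliminating one of them adds arbitrarily many members to \<open>L\<close>, but none to \<open>H\<close>.
\<close>

lemma diagram_determined_poly_families:
  assumes "finite F" "\<And>P. P \<in> F \<Longrightarrow> poly_family d P"
  shows "diagram_determined F"
  using assms
proof (induction d arbitrary: F)
  case 0
  then show ?case by (rule diagram_determined_constant)
next
  case (Suc d)
  have "diagram_determined (H \<union> L)"
    if "finite H" "finite L" "\<And>P. P \<in> H \<Longrightarrow> poly_family (Suc d) P" "\<And>P. P \<in> L \<Longrightarrow> poly_family d P"
    for H L :: "('a \<Rightarrow> real poly) set"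
    using that
  proof (induction H arbitrary: L)
    case empty
    then show ?case using Suc.IH by simp
  next
    case (insert q H)
    have "diagram_determined (insert q (H \<union> L))"
    proof (rule diagram_determined_step[where d = d])
      have "diagram_determined (H \<union> insert (\<lambda>x. poly_cutoff (Suc d) (q x)) L)"
        by (rule insert.IH) (use insert.prems poly_family_cutoff in blast)+
      then show "diagram_determined (insert (\<lambda>x. poly_cutoff (Suc d) (q x)) (H \<union> L))" by simp
      show "diagram_determined (H \<union> L \<union> E)"
        if "finite E" "\<And>R. R \<in> E \<Longrightarrow> poly_family d R" for E
      proof -
        have "diagram_determined (H \<union> (L \<union> E))"
          by (rule insert.IH) (use insert.prems that in auto)
        then show ?thesis by (simp add: Un_assoc)
      qed
    qed (use insert poly_family_mono[of d _ "Suc d"] in auto)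
    then show ?case by simp
  qed
  from this[of F "{}"] show ?case using Suc.prems by simp
qed

section \<open>Projections and images of semialgebraic sets\<close>

lemma polynomial_on_line:
  fixes a :: "'x::real_normed_vector \<Rightarrow> real"
  assumes "real_polynomial_function a"
  shows "\<exists>d P. poly_family d P \<and> (\<forall>x y. a (x + y *\<^sub>R v) = poly (P x) y)"
  using assms
proof (induction rule: real_polynomial_function.induct)
  case (linear h)
  have "poly_family 1 (\<lambda>x. [:h x, h v:])"
    unfolding poly_family_def
  proof (intro conjI allI)
    fix i
    consider "i = 0" | "i = 1" | j where "i = Suc (Suc j)" by (metis One_nat_def not0_implies_Suc)
    then show "real_polynomial_function (\<lambda>x. coeff [:h x, h v:] i)"
      using linear by cases (auto intro: real_polynomial_function.intros)
  qed simp
  moreover have "h (x + y *\<^sub>R v) = poly [:h x, h v:] y" for x y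
    using linear by (simp add: linear_simps)
  ultimately show ?case by blast
next
  case (const c)
  have "poly_family 0 (\<lambda>x::'x. [:c:])"
    by (auto simp: poly_family_def)
  then show ?case by (intro exI[of _ 0] exI[of _ "\<lambda>x. [:c:]"]) simp
next
  case (add f g)
  then obtain d P e R where
    P: "poly_family d P" "\<forall>x y. f (x + y *\<^sub>R v) = poly (P x) y" and
    R: "poly_family e R" "\<forall>x y. g (x + y *\<^sub>R v) = poly (R x) y" by blast
  have "poly_family (max d e) (\<lambda>x. P x + R x)"
    using P(1) R(1) by (auto simp: poly_family_def max.coboundedI1 max.coboundedI2 intro!: degree_add_le)
  moreover have "f (x + y *\<^sub>R v) + g (x + y *\<^sub>R v) = poly (P x + R x) y" for x y
    using P R by simp
  ultimately show ?case by blast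
next
  case (mult f g)
  then obtain d P e R where
    P: "poly_family d P" "\<forall>x y. f (x + y *\<^sub>R v) = poly (P x) y" and
    R: "poly_family e R" "\<forall>x y. g (x + y *\<^sub>R v) = poly (R x) y" by blast
  have "poly_family (d + e) (\<lambda>x. P x * R x)"
    unfolding poly_family_def
  proof (intro conjI allI)
    show "degree (P x * R x) \<le> d + e" for x
      using P(1) R(1) degree_mult_le[of "P x" "R x"] unfolding poly_family_def
      by (meson add_mono order_trans)
    show "real_polynomial_function (\<lambda>x. coeff (P x * R x) i)" for i
      unfolding coeff_mult
      by (intro real_polynomial_function_sum real_polynomial_function.intros finite_atMost
          poly_family_coeff[OF P(1)] poly_family_coeff[OF R(1)])
  qed
  moreover have "f (x + y *\<^sub>R v) * g (x + y *\<^sub>R v) = poly (P x * R x) y" for x y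
    using P R by simp
  ultimately show ?case by blast
qed

text \<open>
  Such a set is the union of some of the finitely many sign classes of \<open>G\<close>, hence semialgebraic. Stating it as an
  invariance spares the elimination of a variable the bookkeeping of a defining formula.
\<close>

definition sign_determined :: "'x::real_normed_vector set \<Rightarrow> bool" where
  "sign_determined D \<longleftrightarrow>
     (\<exists>G. finite G \<and> (\<forall>a\<in>G. real_polynomial_function a) \<and>
        (\<forall>x x'. same_signs G x x' \<longrightarrow> (x \<in> D \<longleftrightarrow> x' \<in> D)))"

text \<open>
  This is the projection theorem. Along the line through \<open>x\<close> in direction \<open>v\<close> the deciding functions
  become a family of polynomials with parameter \<open>x\<close>. If their diagrams at \<open>x\<close> and \<open>x'\<close> are
  isomorphic, a point of \<open>D\<close> on one line is carried to a point of \<open>D\<close> on the other.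
\<close>

lemma sign_determined_project_line:
  fixes D :: "'x::real_normed_vector set"
  assumes "sign_determined D"
  shows "sign_determined {x. \<exists>y. x + y *\<^sub>R v \<in> D}"
proof -
  obtain G where G: "finite G" "\<forall>a\<in>G. real_polynomial_function a"
      "\<And>x x'. same_signs G x x' \<Longrightarrow> x \<in> D \<longleftrightarrow> x' \<in> D"
    using assms unfolding sign_determined_def by blast
  have "\<forall>a\<in>G. \<exists>d P. poly_family d P \<and> (\<forall>x y. a (x + y *\<^sub>R v) = poly (P x) y)"
    using G(2) polynomial_on_line by blast
  then obtain d P where P: "\<And>a. a \<in> G \<Longrightarrow> poly_family (d a) (P a)"
      "\<And>a x y. a \<in> G \<Longrightarrow> a (x + y *\<^sub>R v) = poly (P a x) y"
    by metis
  have "diagram_determined (P ` G)"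
  proof (rule diagram_determined_poly_families[where d = "sum d G"])
    fix R assume "R \<in> P ` G"
    then obtain a where a: "a \<in> G" "R = P a" by blast
    have "d a \<le> sum d G" using G(1) a(1) by (intro member_le_sum) auto
    then show "poly_family (sum d G) R" using P(1)[OF a(1)] a(2) poly_family_mono by blast
  qed (use G in simp)
  then obtain G' where G': "finite G'" "\<forall>a\<in>G'. real_polynomial_function a"
      "\<And>x x'. same_signs G' x x' \<Longrightarrow> sign_isomorphic (P ` G) x x'"
    unfolding diagram_determined_def by blast
  have move: "\<exists>y'. x' + y' *\<^sub>R v \<in> D" if same: "same_signs G' x x'" and y: "x + y *\<^sub>R v \<in> D" for x x' y
  proof -
    obtain \<phi> where \<phi>: "\<forall>R\<in>P ` G. \<forall>y. sgn (poly (R x) y) = sgn (poly (R x') (\<phi> y))"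
      using G'(3)[OF same] unfolding sign_isomorphic_def by blast
    then have "same_signs G (x + y *\<^sub>R v) (x' + \<phi> y *\<^sub>R v)"
      unfolding same_signs_def using P(2) by simp
    then show ?thesis using G(3) y by blast
  qed
  then have "(\<exists>y. x + y *\<^sub>R v \<in> D) \<longleftrightarrow> (\<exists>y. x' + y *\<^sub>R v \<in> D)" if "same_signs G' x x'" for x x'
    using move[OF that] move[OF that[THEN same_signs_sym]] by blast
  then show ?thesis unfolding sign_determined_def using G' by (intro exI[of _ G']) simp
qed

text \<open>
  Projecting along one direction after the other keeps the ambient space, so that an induction over
  its dimension is not necessary. The sets obtained are invariant under translation by \<open>V\<close>.
\<close>

lemma sign_determined_project_span:
  fixes D :: "'x::real_normed_vector set"
  assumes "finite V" "sign_determined D"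
  shows "sign_determined {x. \<exists>w\<in>span V. x + w \<in> D}"
  using assms
proof (induction V)
  case empty
  then show ?case by simp
next
  case (insert v V)
  have eq: "{x. \<exists>w\<in>span (insert v V). x + w \<in> D} =
      {x. \<exists>y. x + y *\<^sub>R v \<in> {x. \<exists>w\<in>span V. x + w \<in> D}}" (is "?L = ?R")
  proof (intro set_eqI iffI)
    fix x assume "x \<in> ?L"
    then obtain w k where "x + w \<in> D" "w - k *\<^sub>R v \<in> span V"
      by (auto simp: span_breakdown_eq)
    moreover have "x + w = x + k *\<^sub>R v + (w - k *\<^sub>R v)" by simp
    ultimately show "x \<in> ?R" by (metis (mono_tags, lifting) mem_Collect_eq)
  next
    fix x assume "x \<in> ?R"
    then obtain y w where w: "w \<in> span V" "x + y *\<^sub>R v + w \<in> D" by blast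
    have "y *\<^sub>R v + w \<in> span (insert v V)" using w(1)
      by (auto simp: span_breakdown_eq intro!: exI[of _ y])
    then show "x \<in> ?L" using w(2) by (auto simp: add.assoc)
  qed
  show ?case
    unfolding eq by (rule sign_determined_project_line[OF insert.IH[OF insert.prems]])
qed

lemma sign_determined_vimage:
  assumes "polynomial_function h" "sign_determined D"
  shows "sign_determined (h -` D)"
proof -
  obtain G where "finite G" "\<forall>a\<in>G. real_polynomial_function a"
      "\<And>x x'. same_signs G x x' \<Longrightarrow> x \<in> D \<longleftrightarrow> x' \<in> D"
    using assms(2) unfolding sign_determined_def by blast
  then show ?thesis
    unfolding sign_determined_def using real_polynomial_function_compose[OF assms(1)]
    by (intro exI[of _ "(\<lambda>a. a \<circ> h) ` G"]) (auto simp: same_signs_def)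
qed

lemma sign_determined_empty: "sign_determined {}"
  unfolding sign_determined_def by (intro exI[of _ "{}"]) simp

lemma sign_determined_boolean:
  assumes "sign_determined D" "sign_determined E"
  shows "sign_determined (D \<union> E)" "sign_determined (D \<inter> E)"
proof -
  obtain G where G: "finite G" "\<forall>a\<in>G. real_polynomial_function a"
      "\<And>x x'. same_signs G x x' \<Longrightarrow> x \<in> D \<longleftrightarrow> x' \<in> D"
    using assms(1) unfolding sign_determined_def by blast
  obtain H where H: "finite H" "\<forall>a\<in>H. real_polynomial_function a"
      "\<And>x x'. same_signs H x x' \<Longrightarrow> x \<in> E \<longleftrightarrow> x' \<in> E"
    using assms(2) unfolding sign_determined_def by blast
  have "same_signs G x x' \<and> same_signs H x x'" if "same_signs (G \<union> H) x x'" for x x'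
    using that by (auto simp: same_signs_def)
  then have "(x \<in> D \<longleftrightarrow> x' \<in> D) \<and> (x \<in> E \<longleftrightarrow> x' \<in> E)" if "same_signs (G \<union> H) x x'" for x x'
    using that G(3) H(3) by blast
  then show "sign_determined (D \<union> E)" "sign_determined (D \<inter> E)"
    unfolding sign_determined_def using G H by (intro exI[of _ "G \<union> H"]; auto)+
qed

lemma sign_determined_zero_set:
  assumes "real_polynomial_function a"
  shows "sign_determined {x. a x = 0}"
proof -
  have "x \<in> {x. a x = 0} \<longleftrightarrow> x' \<in> {x. a x = 0}" if "same_signs {a} x x'" for x x'
    using same_signsD[OF that, of a] by (metis insertI1 mem_Collect_eq sgn_0_0)
  then show ?thesis unfolding sign_determined_def using assms by (intro exI[of _ "{a}"]) simp
qed

lemma semialgebraic_imp_sign_determined: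
  fixes S :: "(real ^ 'n) set"
  assumes "semialgebraic S"
  shows "sign_determined S"
proof -
  have basic: "sign_determined B" if B: "basic_semialgebraic B" for B :: "(real ^ 'n) set"
  proof -
    obtain P Q where PQ: "finite P" "finite Q" "\<forall>p\<in>P. real_polynomial_function p"
      "\<forall>q\<in>Q. real_polynomial_function q" "B = {x. (\<forall>p\<in>P. p x > 0) \<and> (\<forall>q\<in>Q. q x = 0)}"
      using B unfolding basic_semialgebraic_def by blast
    have "x \<in> B \<longleftrightarrow> x' \<in> B" if "same_signs (P \<union> Q) x x'" for x x'
    proof -
      have "a x > 0 \<longleftrightarrow> a x' > 0" "a x = 0 \<longleftrightarrow> a x' = 0" if "a \<in> P \<union> Q" for a
        using same_signsD[OF \<open>same_signs (P \<union> Q) x x'\<close> that]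
        by (auto simp: sgn_if split: if_splits)
      then show ?thesis using PQ(5) by auto
    qed
    then show ?thesis unfolding sign_determined_def using PQ by (intro exI[of _ "P \<union> Q"]) auto
  qed
  obtain \<B> where "finite \<B>" "\<forall>B\<in>\<B>. basic_semialgebraic B" "S = \<Union>\<B>"
    using assms unfolding semialgebraic_def by blast
  moreover have "sign_determined (\<Union>\<B>)" if "finite \<B>" "\<forall>B\<in>\<B>. basic_semialgebraic B"
    for \<B> :: "(real ^ 'n) set set"
    using that by induction (auto intro: basic sign_determined_empty sign_determined_boolean)
  ultimately show ?thesis by blast
qed

lemma span_Basis_Pair_0:
  "span ((\<lambda>b. (b, 0)) ` Basis) = {w :: 'a::euclidean_space \<times> real. snd w = 0}" (is "span ?V = ?U")
proof (intro equalityI subsetI)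
  fix w assume "w \<in> span ?V"
  moreover have "span ?V \<subseteq> ?U"
    by (rule span_minimal) (auto simp: subspace_def)
  ultimately show "w \<in> ?U" by blast
next
  fix w assume w: "w \<in> ?U"
  have "(\<Sum>b\<in>Basis. (fst w \<bullet> b) *\<^sub>R (b, 0::real)) \<in> span ?V"
    by (intro span_sum span_scale span_base) auto
  moreover have "(\<Sum>b\<in>Basis. (fst w \<bullet> b) *\<^sub>R (b, 0::real)) = w"
    using w by (simp add: prod_eq_iff fst_sum snd_sum euclidean_representation)
  ultimately show "w \<in> span ?V" by simp
qed

text \<open>
  The projection along the first factor, a set invariant under translation by that factor, is cut
  with the last axis.
\<close>

lemma sign_determined_snd_image:
  fixes D :: "('a::euclidean_space \<times> real) set"
  assumes "sign_determined D"
  shows "sign_determined (snd ` D)"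
proof -
  define E where "E = {x. \<exists>w\<in>span ((\<lambda>b. (b, 0)) ` Basis). x + w \<in> D}"
  have "sign_determined E"
    unfolding E_def using assms by (intro sign_determined_project_span) auto
  moreover have "polynomial_function (\<lambda>t::real. (0::'a, t))"
    by (intro polynomial_function_bounded_linear bounded_linear_Pair bounded_linear_zero
        bounded_linear_ident)
  ultimately have "sign_determined ((\<lambda>t. (0, t)) -` E)" by (rule sign_determined_vimage[rotated])
  moreover have "(\<lambda>t. (0, t)) -` E = snd ` D"
  proof (intro set_eqI iffI)
    fix t assume "t \<in> snd ` D"
    then obtain x where "(x, t) \<in> D" by auto
    then have "(0, t) + (x, 0) \<in> D" by simp
    then show "t \<in> (\<lambda>t. (0, t)) -` E" unfolding E_def span_Basis_Pair_0 by fastforce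
  qed (auto simp: E_def span_Basis_Pair_0 intro!: image_eqI)
  ultimately show ?thesis by simp
qed

text \<open>
  The image is the projection of the graph of \<open>f\<close> over \<open>S\<close> to the last coordinate.
\<close>

lemma sign_determined_image:
  fixes f :: "'a::euclidean_space \<Rightarrow> real"
  assumes f: "real_polynomial_function f" and S: "sign_determined S"
  shows "sign_determined (f ` S)"
proof -
  have "polynomial_function (fst :: 'a \<times> real \<Rightarrow> 'a)"
    by (intro polynomial_function_bounded_linear bounded_linear_fst)
  then have "sign_determined (fst -` S :: ('a \<times> real) set)"
    and "real_polynomial_function (f \<circ> fst :: 'a \<times> real \<Rightarrow> real)"
    using S f by (auto intro: sign_determined_vimage real_polynomial_function_compose)
  moreover have "real_polynomial_function (snd :: 'a \<times> real \<Rightarrow> real)"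
    by (intro real_polynomial_function.intros bounded_linear_snd)
  ultimately have "sign_determined (fst -` S \<inter> {z :: 'a \<times> real. (f \<circ> fst) z - snd z = 0})"
    by (intro sign_determined_boolean(2) sign_determined_zero_set real_polynomial_function_diff)
  then have "sign_determined (snd ` (fst -` S \<inter> {z :: 'a \<times> real. (f \<circ> fst) z - snd z = 0}))"
    by (rule sign_determined_snd_image)
  moreover have "snd ` (fst -` S \<inter> {z :: 'a \<times> real. (f \<circ> fst) z - snd z = 0}) = f ` S"
  proof (intro set_eqI iffI)
    fix t assume "t \<in> f ` S"
    then obtain x where "x \<in> S" "t = f x" by blast
    then have "(x, t) \<in> fst -` S \<inter> {z. (f \<circ> fst) z - snd z = 0}" by simp
    then show "t \<in> snd ` (fst -` S \<inter> {z. (f \<circ> fst) z - snd z = 0})"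
      by (rule image_eqI[rotated]) simp
  qed auto
  ultimately show ?thesis by simp
qed

text \<open>
  On an interval without roots of the deciding polynomials their signs are constant, so the interval
  lies inside \<open>T\<close> or misses it. Thus \<open>T\<close> consists of some of the finitely many roots and of some
  of the gaps between them.
\<close>

lemma bounded_sign_determined_closure:
  fixes T :: "real set"
  assumes "sign_determined T" "bounded T"
  shows "\<exists>J. finite J \<and> (\<forall>(a, b)\<in>J. a \<le> b) \<and> closure T = (\<Union>(a, b)\<in>J. {a..b})"
proof -
  obtain G where G: "finite G" "\<forall>a\<in>G. real_polynomial_function a"
      "\<And>x x'. same_signs G x x' \<Longrightarrow> x \<in> T \<longleftrightarrow> x' \<in> T"
    using assms(1) unfolding sign_determined_def by blast
  have "\<exists>r. \<forall>y. a y = poly r y" if "a \<in> G" for a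
  proof -
    have "real_polynomial_function a" using G(2) that by blast
    then obtain P where "\<forall>x y. a (x + y *\<^sub>R 1) = poly (P x) y"
      using polynomial_on_line[of a 1] by blast
    then have "a (0 + y *\<^sub>R 1) = poly (P 0) y" for y by blast
    then show ?thesis by auto
  qed
  then obtain r where r: "\<And>a y. a \<in> G \<Longrightarrow> a y = poly (r a) y" by metis
  obtain M where M: "\<And>t. t \<in> T \<Longrightarrow> \<bar>t\<bar> \<le> M"
    using assms(2) by (auto simp: bounded_iff)
  \<comment> \<open>a bound of \<open>T\<close> and its negative are added so that every point of \<open>T\<close> lies in \<open>Z\<close> or in a bounded gap\<close>
  define Z where "Z = {-M, M} \<union> (\<Union>a\<in>{a\<in>G. r a \<noteq> 0}. {y. poly (r a) y = 0})"
  have Z: "finite Z" "-M \<in> Z" "M \<in> Z"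
    unfolding Z_def using G(1) by (auto intro: poly_roots_finite)
  have conn: "u \<in> T" if tu: "t \<in> T" "\<And>y. min t u \<le> y \<Longrightarrow> y \<le> max t u \<Longrightarrow> y \<notin> Z" for t u
  proof -
    have "sgn (a t) = sgn (a u)" if a: "a \<in> G" for a
    proof (cases "r a = 0")
      case False
      then have "sgn (poly (r a) t) = sgn (poly (r a) u)"
        using tu(2) a by (intro poly_sgn_eq_of_no_root) (auto simp: Z_def)
      then show ?thesis using r[OF a] by simp
    qed (use r[OF a] in simp)
    then show ?thesis using G(3) tu(1) by (auto simp: same_signs_def)
  qed
  define J where "J = {(a, b). a \<in> Z \<and> b \<in> Z \<and> a \<le> b \<and> {a..b} \<subseteq> closure T}"
  have finJ: "finite J"
    by (rule finite_subset[of _ "Z \<times> Z"]) (use Z in \<open>auto simp: J_def\<close>)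
  have "t \<in> (\<Union>(a, b)\<in>J. {a..b})" if t: "t \<in> T" for t
  proof (cases "t \<in> Z")
    case True
    then have "(t, t) \<in> J" using t closure_subset by (auto simp: J_def)
    then show ?thesis by force
  next
    case False
    define a where "a = Max {w\<in>Z. w < t}"
    define b where "b = Min {w\<in>Z. t < w}"
    have "- M < t" "t < M"
      using M[OF t] False Z by (metis abs_le_iff minus_le_iff order_le_imp_less_or_eq)+
    then have "finite {w\<in>Z. w < t}" "{w\<in>Z. w < t} \<noteq> {}" "finite {w\<in>Z. t < w}" "{w\<in>Z. t < w} \<noteq> {}"
      using Z by auto
    note ab = Max_in[OF this(1,2), folded a_def] Max_ge[OF this(1), folded a_def]
      Min_in[OF this(3,4), folded b_def] Min_le[OF this(3), folded b_def]
    have gap: "w \<notin> Z" if "a < w" "w < b" for w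
      using ab that False by (cases "w < t"; cases "t < w") force+
    have "u \<in> T" if "a < u" "u < b" for u
    proof (rule conn[OF t])
      fix y assume "min t u \<le> y" "y \<le> max t u"
      then have "a < y" "y < b" using that ab by (auto simp: min_def max_def split: if_splits)
      then show "y \<notin> Z" using gap by blast
    qed
    then have "{a<..<b} \<subseteq> T" by auto
    then have "{a..b} \<subseteq> closure T"
      using closure_mono[of "{a<..<b}" T] ab by (simp add: closure_greaterThanLessThan)
    then have "(a, b) \<in> J" using ab by (auto simp: J_def)
    then show ?thesis using ab by force
  qed
  then have "T \<subseteq> (\<Union>(a, b)\<in>J. {a..b})" by blast
  moreover have "closed (\<Union>(a, b)\<in>J. {a..b})"
    using finJ by (intro closed_UN) auto
  ultimately have "closure T \<subseteq> (\<Union>(a, b)\<in>J. {a..b})" by (rule closure_minimal)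
  moreover have "(\<Union>(a, b)\<in>J. {a..b}) \<subseteq> closure T" by (auto simp: J_def)
  ultimately have "closure T = (\<Union>(a, b)\<in>J. {a..b})" by (rule equalityI)
  moreover have "\<forall>(a, b)\<in>J. a \<le> b" by (auto simp: J_def)
  ultimately show ?thesis using finJ by blast
qed

section \<open>Exact relaxations on intervals\<close>

lemma only_simple_roots_linear:
  assumes "degree r = 1"
  shows "only_simple_roots r"
  unfolding only_simple_roots_def
proof (intro conjI allI impI)
  show "r \<noteq> 0" using assms by auto
  fix z assume z: "poly (cpoly r) z = 0"
  have "degree (cpoly r) = 1" using assms by (simp add: degree_map_poly)
  moreover from this have "cpoly r \<noteq> 0" by auto
  ultimately have "cpoly r \<noteq> 0" "order z (cpoly r) \<le> 1"
    using order_degree[of "cpoly r" z] by auto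
  then show "order z (cpoly r) = 1" using z order_root[of "cpoly r" z] by auto
qed

lemma sos_0: "0 \<in> sos" and sos_1: "1 \<in> sos"
proof -
  have "0 = (\<Sum>i<0. (h i)\<^sup>2)" for h :: "nat \<Rightarrow> real poly" by simp
  then show "0 \<in> sos" unfolding sos_def by blast
  show "1 \<in> sos"
    unfolding sos_def by (auto intro!: exI[of _ "\<lambda>_. 1"] exI[of _ "1::nat"])
qed

lemma truncated_preorderingI:
  assumes "h = (\<Sum>A\<in>Pow p. \<sigma> A * \<Prod>A) + (\<Sum>r\<in>q. \<psi> r * r)"
    and "\<And>A. A \<subseteq> p \<Longrightarrow> \<sigma> A \<in> sos \<and> degree (\<sigma> A * \<Prod>A) \<le> 2 * k"
    and "\<And>r. r \<in> q \<Longrightarrow> degree (\<psi> r * r) \<le> 2 * k"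
  shows "h \<in> truncated_preordering k p q"
  using assms unfolding truncated_preordering_def by blast

lemma inequality_in_truncated_preordering:
  assumes "finite p" "r \<in> p" "degree r \<le> 2 * k"
  shows "r \<in> truncated_preordering k p q"
proof -
  define \<sigma> where "\<sigma> A = (if A = {r} then 1 else 0 :: real poly)" for A
  have "(\<Sum>A\<in>Pow p. \<sigma> A * \<Prod>A) = (\<Sum>A\<in>Pow p. if A = {r} then r else 0)"
    by (rule sum.cong) (auto simp: \<sigma>_def)
  also have "\<dots> = r" using assms by simp
  finally have sum: "(\<Sum>A\<in>Pow p. \<sigma> A * \<Prod>A) = r" .
  show ?thesis
    by (rule truncated_preorderingI[where \<sigma> = \<sigma> and \<psi> = "\<lambda>_. 0"])
      (use assms sum sos_0 sos_1 in \<open>auto simp: \<sigma>_def\<close>)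
qed

lemma equation_in_truncated_preordering:
  assumes "finite q" "r \<in> q" "degree r \<le> 2 * k"
  shows "r \<in> truncated_preordering k p q"
proof -
  define \<psi> where "\<psi> s = (if s = r then 1 else 0 :: real poly)" for s
  have "(\<Sum>s\<in>q. \<psi> s * s) = (\<Sum>s\<in>q. if s = r then r else 0)"
    by (rule sum.cong) (auto simp: \<psi>_def)
  also have "\<dots> = r" using assms by simp
  finally have sum: "(\<Sum>s\<in>q. \<psi> s * s) = r" .
  show ?thesis
    by (rule truncated_preorderingI[where \<sigma> = "\<lambda>_. 0" and \<psi> = \<psi>])
      (use assms sum sos_0 in \<open>auto simp: \<psi>_def\<close>)
qed

lemma sos_nonneg: "s \<in> sos \<Longrightarrow> poly s t \<ge> 0"
  by (auto simp: sos_def poly_sum intro!: sum_nonneg)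

text \<open>
  This is the easy half of duality: every certified lower bound is a lower bound.
\<close>

lemma truncated_preordering_nonneg:
  assumes "h \<in> truncated_preordering k p q" "t \<in> feasible_set p q"
  shows "poly h t \<ge> 0"
proof -
  obtain \<sigma> \<psi> where h: "h = (\<Sum>A\<in>Pow p. \<sigma> A * \<Prod>A) + (\<Sum>r\<in>q. \<psi> r * r)"
      and \<sigma>: "\<And>A. A \<subseteq> p \<Longrightarrow> \<sigma> A \<in> sos"
    using assms(1) unfolding truncated_preordering_def by blast
  have "poly (\<sigma> A * \<Prod>A) t \<ge> 0" if "A \<subseteq> p" for A
    using that assms(2) sos_nonneg[OF \<sigma>]
    by (auto simp: feasible_set_def poly_prod intro!: mult_nonneg_nonneg prod_nonneg)
  then have "0 \<le> (\<Sum>A\<in>Pow p. poly (\<sigma> A * \<Prod>A) t)" by (intro sum_nonneg) auto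
  moreover have "(\<Sum>r\<in>q. poly (\<psi> r * r) t) = 0"
    using assms(2) by (intro sum.neutral) (simp add: feasible_set_def)
  ultimately show ?thesis by (simp add: h poly_sum)
qed

text \<open>
  A certified bound above \<open>a\<close> would contradict the value of the objective at the feasible point \<open>a\<close>,
  and \<open>t - a\<close> certifies \<open>a\<close> itself.
\<close>

lemma rho_eq_endpoint:
  assumes "a \<in> feasible_set p q" "[:-a, 1:] \<in> truncated_preordering k p q"
  shows "rho k [:0, 1:] p q = ereal a"
  unfolding rho_def
proof (rule antisym)
  show "(SUP c\<in>{c. [:0, 1:] - [:c:] \<in> truncated_preordering k p q}. ereal c) \<le> ereal a"
  proof (rule SUP_least)
    fix c assume "c \<in> {c. [:0, 1:] - [:c:] \<in> truncated_preordering k p q}"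
    then have "poly ([:0, 1:] - [:c:]) a \<ge> 0"
      using truncated_preordering_nonneg assms(1) by blast
    then show "ereal c \<le> ereal a" by simp
  qed
  show "ereal a \<le> (SUP c\<in>{c. [:0, 1:] - [:c:] \<in> truncated_preordering k p q}. ereal c)"
    using assms(2) by (intro SUP_upper) simp
qed

text \<open>
  The interval \<open>{a..b}\<close> is described by \<open>t - a \<ge> 0\<close> and \<open>b - t \<ge> 0\<close>. For \<open>a = b\<close> these two
  polynomials would share their root, so a single point is described by the equation \<open>t - a = 0\<close>
  instead.
\<close>

definition interval_inequalities :: "real \<Rightarrow> real \<Rightarrow> real poly set" where
  "interval_inequalities a b = (if a < b then {[:-a, 1:], [:b, -1:]} else {})"

definition interval_equations :: "real \<Rightarrow> real \<Rightarrow> real poly set" where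
  "interval_equations a b = (if a < b then {} else {[:-a, 1:]})"

lemma finite_interval_constraints:
  "finite (interval_inequalities a b)" "finite (interval_equations a b)"
  by (simp_all add: interval_inequalities_def interval_equations_def)

lemma feasible_set_interval:
  assumes "a \<le> b"
  shows "feasible_set (interval_inequalities a b) (interval_equations a b) = {a..b}"
  using assms
  by (auto simp: feasible_set_def interval_inequalities_def interval_equations_def)

lemma interval_inequalities_simple:
  "r \<in> interval_inequalities a b \<Longrightarrow> only_simple_roots r"
  by (auto simp: interval_inequalities_def intro: only_simple_roots_linear split: if_splits)

lemma interval_inequalities_coprime:
  assumes "r \<in> interval_inequalities a b" "s \<in> interval_inequalities a b" "r \<noteq> s"
  shows "no_common_root r s"
proof -
  have "\<not> (poly (cpoly [:-a, 1:]) z = 0 \<and> poly (cpoly [:b, -1:]) z = 0)" if "a < b" for z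
  proof
    assume "poly (cpoly [:-a, 1:]) z = 0 \<and> poly (cpoly [:b, -1:]) z = 0"
    then have "complex_of_real a = complex_of_real b" by (simp add: map_poly_pCons)
    then show False using that by (simp only: of_real_eq_iff)
  qed
  then show ?thesis
    using assms by (auto simp: interval_inequalities_def no_common_root_def split: if_splits)
qed

text \<open>
  The polynomial \<open>t - a\<close> is one of the constraints, hence its own certificate; it has degree \<open>1\<close>, which
  the degree bound \<open>2 * k\<close> admits from \<open>k = 1\<close> on.
\<close>

lemma rho_interval:
  assumes "a \<le> b" "k \<ge> 1"
  shows "rho k [:0, 1:] (interval_inequalities a b) (interval_equations a b) = ereal a"
proof (rule rho_eq_endpoint)
  show "a \<in> feasible_set (interval_inequalities a b) (interval_equations a b)"
    using assms by (simp add: feasible_set_interval)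
  show "[:-a, 1:] \<in> truncated_preordering k (interval_inequalities a b) (interval_equations a b)"
  proof (cases "a < b")
    case True
    then show ?thesis
      using assms by (intro inequality_in_truncated_preordering finite_interval_constraints)
        (auto simp: interval_inequalities_def)
  next
    case False
    then show ?thesis
      using assms by (intro equation_in_truncated_preordering finite_interval_constraints)
        (auto simp: interval_equations_def)
  qed
qed

lemma real_INF_in_closure:
  fixes f :: "'a \<Rightarrow> real"
  assumes "ereal m = (INF x\<in>S. ereal (f x))"
  shows "m \<in> closure (f ` S)" "\<And>t. t \<in> closure (f ` S) \<Longrightarrow> m \<le> t"
proof -
  have "\<exists>y\<in>f ` S. dist y m < e" if "e > 0" for e
  proof -
    have "(INF x\<in>S. ereal (f x)) < ereal (m + e)" using assms[symmetric] that by simp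
    then obtain x where x: "x \<in> S" "f x < m + e" by (auto simp: INF_less_iff)
    moreover have "ereal m \<le> ereal (f x)" unfolding assms using x(1) by (rule INF_lower)
    ultimately have "dist (f x) m < e" by (simp add: dist_real_def)
    then show ?thesis using x(1) by blast
  qed
  then show "m \<in> closure (f ` S)" by (simp add: closure_approachable)
  have "f ` S \<subseteq> {m..}"
  proof
    fix t assume "t \<in> f ` S"
    then have "ereal m \<le> ereal t" unfolding assms by (auto intro: INF_lower)
    then show "t \<in> {m..}" by simp
  qed
  then have "closure (f ` S) \<subseteq> {m..}" by (rule closure_minimal) simp
  then show "m \<le> t" if "t \<in> closure (f ` S)" for t using that by auto
qed

theorem corollary1:
  fixes f :: "real ^ 'n \<Rightarrow> real" and S :: "(real ^ 'n) set"
    and fstar :: real and Q :: "real set" and g :: "real poly"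
  assumes "real_polynomial_function f"
    and "semialgebraic S"
    and "ereal fstar = (INF x\<in>S. ereal (f x))"
    and "bounded (f ` S)"
    and "Q = closure (f ` S)"
    and "g = [:0, 1:]"
  shows "\<exists>(w::nat) (p :: nat \<Rightarrow> real poly set) (q :: nat \<Rightarrow> real poly set).
    (\<forall>j\<in>{1..w}. finite (p j) \<and> finite (q j)) \<and>
    (\<exists>t\<in>Q. fstar = poly g t) \<and> (\<forall>t\<in>Q. fstar \<le> poly g t) \<and>
    Q = (\<Union>j\<in>{1..w}. feasible_set (p j) (q j)) \<and>
    (\<forall>j\<in>{1..w}. (\<forall>r\<in>p j. only_simple_roots r) \<and>
                 (\<forall>r\<in>p j. \<forall>s\<in>p j. r \<noteq> s \<longrightarrow> no_common_root r s)) \<and>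
    (\<exists>K::nat. \<forall>k\<ge>K. ereal fstar = (MIN j\<in>{1..w}. rho k g (p j) (q j)))"
proof -
  obtain J where J: "finite J" "\<forall>(a, b)\<in>J. a \<le> b" "Q = (\<Union>(a, b)\<in>J. {a..b})"
    using bounded_sign_determined_closure[OF sign_determined_image[OF assms(1)
        semialgebraic_imp_sign_determined[OF assms(2)]] assms(4)]
    by (auto simp: assms(5))
  have fstar: "fstar \<in> Q" "\<And>t. t \<in> Q \<Longrightarrow> fstar \<le> t"
    using real_INF_in_closure[OF assms(3)] by (simp_all add: assms(5))
  obtain e where e: "bij_betw e {1..card J} J" using ex_bij_betw_nat_finite_1[OF J(1)] by blast
  define w where "w = card J"
  define l where "l j = fst (e j)" for j
  define u where "u j = snd (e j)" for j
  have lu: "l j \<le> u j" if "j \<in> {1..w}" for j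
  proof -
    have "e j \<in> J" using bij_betwE[OF e] that by (simp add: w_def)
    then show ?thesis using J(2) by (auto simp: l_def u_def)
  qed
  have "J = (\<lambda>j. (l j, u j)) ` {1..w}"
    using bij_betw_imp_surj_on[OF e] by (simp add: l_def u_def w_def)
  then have Q: "Q = (\<Union>j\<in>{1..w}. {l j..u j})" using J(3) by simp
  define p where "p j = interval_inequalities (l j) (u j)" for j
  define q where "q j = interval_equations (l j) (u j)" for j
  have rho: "rho k g (p j) (q j) = ereal (l j)" if "j \<in> {1..w}" "k \<ge> 1" for j k
    using rho_interval[OF lu[OF that(1)] that(2)] by (simp add: p_def q_def assms(6))
  have "ereal fstar = (MIN j\<in>{1..w}. rho k g (p j) (q j))" if k: "k \<ge> 1" for k
  proof (rule Min_eqI[symmetric])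
    fix y assume "y \<in> (\<lambda>j. rho k g (p j) (q j)) ` {1..w}"
    then obtain j where j: "j \<in> {1..w}" "y = ereal (l j)" using rho k by auto
    then have "l j \<in> Q" using lu by (auto simp: Q)
    then show "ereal fstar \<le> y" using fstar(2) j by simp
  next
    obtain j where j: "j \<in> {1..w}" "fstar \<in> {l j..u j}" using fstar(1) Q by blast
    moreover have "l j \<in> Q" using lu j(1) by (auto simp: Q)
    \<comment> \<open>\<open>fstar\<close> is the least element of \<open>Q\<close>, and \<open>l j\<close> lies in \<open>Q\<close> at or below it\<close>
    ultimately have "l j = fstar" using fstar(2) by force
    then show "ereal fstar \<in> (\<lambda>j. rho k g (p j) (q j)) ` {1..w}" using rho[OF j(1) k] j(1) by force
  qed simp
  moreover have "Q = (\<Union>j\<in>{1..w}. feasible_set (p j) (q j))"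
    using lu by (simp add: Q p_def q_def feasible_set_interval)
  moreover have "\<forall>j\<in>{1..w}. finite (p j) \<and> finite (q j)"
    by (simp add: p_def q_def finite_interval_constraints)
  moreover have "\<forall>j\<in>{1..w}. (\<forall>r\<in>p j. only_simple_roots r) \<and>
      (\<forall>r\<in>p j. \<forall>s\<in>p j. r \<noteq> s \<longrightarrow> no_common_root r s)"
    using interval_inequalities_simple interval_inequalities_coprime by (auto simp: p_def)
  moreover have "\<exists>t\<in>Q. fstar = poly g t" "\<forall>t\<in>Q. fstar \<le> poly g t"
    using fstar by (auto simp: assms(6))
  ultimately show ?thesis by blast
qed

end
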